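(* Let $-\pi/2<\lambda<\pi/2$. Let $q$ be analytic in $\mathbb{D}$ with $q(0)=1$, and suppose that $q$ satisfies the differential subordination \[ q(z)+\frac{zq'(z)}{q(z)}\prec P_{\lambda}(z)\quad\text{in } \mathbb{D}. \] Let \[ R_{1}(\lambda)=\sup\{r<1 :\ Q_{\lambda}(rz)\prec P_{\lambda}(rz)\ \text{in } \mathbb{D}\}. \] Then \[ q(z)\prec Q_{\lambda}(z)\quad\text{in } |z|<R_{1}(\lambda). \]
   Context: $\mathbb{D}=\{z\in\mathbb{C}:|z|<1\}$. For analytic functions $f,F$ on $\mathbb{D}$, $f$ is subordinate to $F$ in $\mathbb{D}$, written $f\prec F$ or $f(z)\prec F(z)$, if there is an analytic function $\omega$ on $\mathbb{D}$ with $\omega(0)=0$, $|\omega(z)|<1$ and $f(z)=F(\omega(z))$ for all $z\in\mathbb{D}$. For $0<R\le 1$, "$f(z)\prec F(z)$ in $|z|<R$" means that $z\mapsto f(Rz)$ is subordinate to $z\mapsto F(Rz)$ in $\mathbb{D}$. A subordination asserted or assumed includes the requirement that the functions involved are analytic in the disc in question (with removable singularities removed); in particular, the hypothesis on $q$ includes that $q+zq'/q$ is analytic in $\mathbb{D}$. The values $r$ in the definition of $R_1(\lambda)$ are in $(0,1)$. For $-\pi/2<\lambda<\pi/2$, \[ P_{\lambda}(z)=\frac{1+e^{2i\lambda}z}{1-z},\qquad Q_{\lambda}(z)=\frac{zf_\lambda'(z)}{f_\lambda(z)}=\frac{e^{2i\lambda}z}{1-z-(1-z)^{1+e^{2i\lambda}}},\qquad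 Q_\lambda(0)=1, \] where $f_{\lambda}(z)=\dfrac{(1-z)^{1-2e^{i\lambda}\cos\lambda}-1}{2e^{i\lambda}\cos\lambda-1}$ and powers of $1-z$ are taken with the principal branch (value $1$ at $z=0$). *)

theory Defs
  imports "HOL-Complex_Analysis.Complex_Analysis"
begin

definition subordinate :: "(complex \<Rightarrow> complex) \<Rightarrow> (complex \<Rightarrow> complex) \<Rightarrow> bool"
    (infix "\<prec>\<^sub>s" 50) where
  "f \<prec>\<^sub>s F \<longleftrightarrow>
     f holomorphic_on ball 0 1 \<and> F holomorphic_on ball 0 1 \<and>
     (\<exists>\<omega>. \<omega> holomorphic_on ball 0 1 \<and> \<omega> 0 = 0 \<and>
          (\<forall>z\<in>ball 0 1. norm (\<omega> z) < 1 \<and> f z = F (\<omega> z)))"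

definition subordinate_in :: "real \<Rightarrow> (complex \<Rightarrow> complex) \<Rightarrow> (complex \<Rightarrow> complex) \<Rightarrow> bool" where
  "subordinate_in R f F \<longleftrightarrow>
     (\<lambda>z. f (complex_of_real R * z)) \<prec>\<^sub>s (\<lambda>z. F (complex_of_real R * z))"

definition P_fun :: "real \<Rightarrow> complex \<Rightarrow> complex" where
  "P_fun lam z = (1 + exp (2 * \<i> * of_real lam) * z) / (1 - z)"

text \<open>The complex power below is taken with the principal branch of the logarithm.\<close>

definition f_fun :: "real \<Rightarrow> complex \<Rightarrow> complex" where
  "f_fun lam z =
     ((1 - z) powr (1 - 2 * exp (\<i> * of_real lam) * of_real (cos lam)) - 1)
       / (2 * exp (\<i> * of_real lam) * of_real (cos lam) - 1)"

text \<open>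
  For some values of the parameter (for instance \<open>pi/4\<close>) the function \<open>f_fun\<close> has further zeros
  in the unit disc, which are genuine poles of the quotient. The convention \<open>x / 0 = 0\<close> does not
  hide them: the quotient is unbounded nearby, hence not holomorphic on any disc containing such
  a point.
\<close>

definition Q_fun :: "real \<Rightarrow> complex \<Rightarrow> complex" where
  "Q_fun lam z = (if z = 0 then 1 else z * deriv (f_fun lam) z / f_fun lam z)"

definition R1 :: "real \<Rightarrow> real" where
  "R1 lam = Sup {r. 0 < r \<and> r < 1 \<and> subordinate_in r (Q_fun lam) (P_fun lam)}"

lemma two_exp_cos: "2 * exp (\<i> * of_real lam) * of_real (cos lam) = exp (2 * \<i> * of_real lam) + 1"
proof -
  have "of_real (cos lam) = (exp (\<i> * of_real lam) + exp (- (\<i> * of_real lam))) / (2::complex)"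
    by (simp add: cos_exp_eq flip: cos_of_real)
  then have "2 * exp (\<i> * of_real lam) * of_real (cos lam)
      = exp (\<i> * of_real lam) * (exp (\<i> * of_real lam) + exp (- (\<i> * of_real lam)))"
    by (simp add: mult.commute)
  also have "\<dots> = exp (\<i> * of_real lam + \<i> * of_real lam) + 1"
    unfolding distrib_left exp_add by (simp add: exp_minus)
  also have "\<i> * of_real lam + \<i> * of_real lam = 2 * \<i> * complex_of_real lam"
    by simp
  finally show ?thesis .
qed

lemma f_fun_eq:
  "f_fun lam z = ((1 - z) powr (- exp (2 * \<i> * of_real lam)) - 1) / exp (2 * \<i> * of_real lam)"
  by (simp add: f_fun_def two_exp_cos)

lemma deriv_f_fun:
  assumes "norm z < 1"
  shows "deriv (f_fun lam) z = (1 - z) powr (- exp (2 * \<i> * of_real lam) - 1)"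
proof -
  have "Re z < 1"
    using assms complex_Re_le_cmod[of z] by linarith
  then have nn: "1 - z \<notin> \<real>\<^sub>\<le>\<^sub>0"
    by (auto simp: complex_nonpos_Reals_iff)
  have "(f_fun lam has_field_derivative (1 - z) powr (- exp (2 * \<i> * of_real lam) - 1)) (at z)"
    unfolding f_fun_eq[abs_def]
    using nn by (auto intro!: derivative_eq_intros)
  then show ?thesis
    by (rule DERIV_imp_deriv)
qed

lemma Q_fun_explicit:
  assumes "norm z < 1" "z \<noteq> 0"
  shows "Q_fun lam z = exp (2 * \<i> * of_real lam) * z
           / (1 - z - (1 - z) powr (1 + exp (2 * \<i> * of_real lam)))"
proof -
  define e where "e = exp (2 * \<i> * of_real lam)"
  define w where "w = (1 - z) powr e"
  have z1: "1 - z \<noteq> 0" using assms by auto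
  have w0: "w \<noteq> 0" using z1 by (simp add: w_def)
  have p1: "(1 - z) powr (- e) = 1 / w"
    by (simp add: w_def powr_minus field_simps)
  have p2: "(1 - z) powr (- e - 1) = 1 / (w * (1 - z))"
    using z1 by (simp add: powr_diff p1)
  have p3: "(1 - z) powr (1 + e) = (1 - z) * w"
    using z1 by (simp add: powr_add w_def)
  have e0: "e \<noteq> 0" by (simp add: e_def)
  have "Q_fun lam z = z * (1 / (w * (1 - z))) / ((1 / w - 1) / e)"
    using assms by (simp add: Q_fun_def deriv_f_fun f_fun_eq p1 p2 flip: e_def)
  also have "(1 / w - 1) / e = (1 - w) / (w * e)"
    using w0 e0 by (simp add: field_simps)
  also have "z * (1 / (w * (1 - z))) / ((1 - w) / (w * e)) = e * z / ((1 - z) * (1 - w))"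
    using w0 e0 z1 by (cases "w = 1") (simp_all add: divide_simps)
  also have "(1 - z) * (1 - w) = 1 - z - (1 - z) powr (1 + e)"
    by (simp add: p3 algebra_simps)
  finally show ?thesis by (simp add: e_def)
qed

end

theory Submission imports Defs begin

text \<open>
  Write \<open>P\<close>, \<open>Q\<close> for \<open>P_fun lam\<close>, \<open>Q_fun lam\<close> and \<open>R\<close> for \<open>R1 lam\<close>. The hypothesis reads
  \<open>z q' = q (P \<circ> w - q)\<close> with a Schwarz function \<open>w\<close>, while \<open>Q\<close> solves the same Riccati equation
  with \<open>w\<close> the identity. The goal is an analytic \<open>\<omega>\<close> on the disc of radius \<open>R\<close> with \<open>\<omega> 0 = 0\<close>,
  \<open>\<bar>\<omega>\<bar> < R\<close> and \<open>q = Q \<circ> \<omega>\<close>.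

  The function \<open>Q\<close> is not known to be univalent on that disc, so \<open>\<omega>\<close> cannot be written as an inverse of
  \<open>Q\<close> composed with \<open>q\<close>. But \<open>Q\<close> is locally univalent there: by definition of \<open>R\<close>, \<open>Q = P \<circ> \<phi>\<close> with
  \<open>\<bar>\<phi> z\<bar> \<le> \<bar>z\<bar>\<close>, so a critical point of \<open>Q\<close> would be a point with \<open>P = Q\<close>, that is a nonzero fixed
  point of \<open>\<phi>\<close>; then \<open>\<phi>\<close> would be the identity, contradicting \<open>2 Q'(0) = P'(0) \<noteq> 0\<close>
  (\<open>Q_fun_in_R1_disc\<close>). Hence \<open>\<omega>\<close> can be obtained by continuing a germ from the origin, provided that
  it never leaves a compact part of the disc (\<open>centred_lift_exists\<close>).

  That a priori bound is \<open>\<bar>\<omega> z\<bar> \<le> \<bar>z\<bar>\<close>, proved in \<open>lift_norm_le\<close> by the method of Miller and Mocanu. If it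
  failed, Jack's lemma (\<open>jack_boundary_point\<close>) would give \<open>z0\<close> with
  \<open>\<bar>\<omega> z0\<bar> = \<bar>z0\<bar>\<close> and \<open>z0 \<omega>'(z0) = m \<omega> z0\<close> for a real \<open>m \<ge> 1\<close>. Substituting into the two Riccati
  equations gives, with \<open>y = \<omega> z0\<close>,
  \<open>P (w z0) - Q y = m (P y - Q y)\<close>. Now \<open>P\<close> maps the disc of radius \<open>\<bar>z0\<bar>\<close> onto a disc whose closure
  contains \<open>Q y\<close> and whose boundary contains \<open>P y\<close>, so continuing the segment from \<open>Q y\<close> beyond
  \<open>P y\<close> cannot lead back into the open disc (\<open>disc_no_outward_ray\<close>). This contradicts \<open>\<bar>w z0\<bar> < \<bar>z0\<bar>\<close>.

  The strict inequality fails when \<open>w\<close> is a rotation. The argument is therefore applied to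
  \<open>q (\<sigma> z)\<close> with \<open>\<sigma> < 1\<close>, whose \<open>w (\<sigma> z)\<close> is strictly contracting; undoing the dilation gives lifts
  of \<open>q\<close> on all discs of radius smaller than \<open>R\<close>, and these agree by the identity theorem, so they
  define \<open>\<omega>\<close> on the whole disc.
\<close>

section \<open>Dilations of the variable\<close>

lemma holomorphic_on_dilate:
  fixes c :: complex
  assumes "g holomorphic_on ball 0 b" "c \<noteq> 0" "norm c * a \<le> b"
  shows "(\<lambda>z. g (c * z)) holomorphic_on ball 0 a"
proof (rule holomorphic_on_compose_gen[OF _ assms(1), of "\<lambda>z. c * z", unfolded o_def])
  have "norm (c * z) < b" if "norm z < a" for z
  proof -
    have "norm (c * z) < norm c * a" using that assms(2) by (simp add: norm_mult)
    then show ?thesis using assms(3) by simp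
  qed
  then show "(\<lambda>z. c * z) ` ball 0 a \<subseteq> ball 0 b" by auto
qed (intro holomorphic_intros)

lemma holomorphic_on_dilate_divide:
  assumes "g holomorphic_on ball 0 b" "0 < r" "a \<le> r * b"
  shows "(\<lambda>z. g (z / complex_of_real r)) holomorphic_on ball 0 a"
  using holomorphic_on_dilate[OF assms(1), of "1 / of_real r" a] assms(2,3)
  by (simp add: norm_divide divide_simps mult.commute)

section \<open>Jack's lemma\<close>

text \<open>
  The point \<open>z0\<close> is a point of least modulus at which \<open>k z = \<omega> z / z\<close> reaches modulus \<open>1\<close>. There \<open>\<bar>k\<bar>\<close> is
  maximal over the closed disc of radius \<open>\<bar>z0\<bar>\<close>, so its derivative along the circle vanishes and its
  outward radial derivative is nonnegative; together these say that \<open>z0 k'(z0) / k z0\<close> is real and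
  nonnegative, and this number is \<open>m - 1\<close>.
\<close>

lemma jack_boundary_point:
  fixes \<omega> :: "complex \<Rightarrow> complex"
  assumes hol: "\<omega> holomorphic_on ball 0 s" and zero: "\<omega> 0 = 0"
    and small: "norm (deriv \<omega> 0) < 1"
    and z1: "z1 \<in> ball 0 s" "norm (\<omega> z1) > norm z1"
  obtains z0 m where "z0 \<noteq> 0" "norm z0 \<le> norm z1" "norm (\<omega> z0) = norm z0"
    "m \<ge> 1" "z0 * deriv \<omega> z0 = of_real m * \<omega> z0"
proof -
  define k where "k z = (if z = 0 then deriv \<omega> 0 else \<omega> z / z)" for z
  have s0: "0 < s" using z1 by (auto intro: le_less_trans[OF norm_ge_zero])
  have khol: "k holomorphic_on ball 0 s"
    by (rule pole_theorem_open_0[OF hol, where a = 0]) (auto simp: k_def zero)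
  have kcont: "continuous_on (cball 0 (norm z1)) k"
    by (rule holomorphic_on_imp_continuous_on, rule holomorphic_on_subset[OF khol])
       (use z1 in auto)
  have omega_eq: "\<omega> z = z * k z" for z by (simp add: k_def zero)
  have z1_0: "z1 \<noteq> 0" using z1 zero by auto
  \<comment> \<open>For \<open>z \<noteq> 0\<close>, points of \<open>K\<close> are those with \<open>\<bar>\<omega> z\<bar> \<ge> \<bar>z\<bar>\<close>; the value \<open>\<omega>'(0)\<close> of \<open>k\<close> keeps \<open>0\<close> out of \<open>K\<close>.\<close>
  define K where "K = {z \<in> cball 0 (norm z1). k z \<in> - ball 0 1}"
  have "compact K"
  proof -
    have "closed K" unfolding K_def
      using continuous_closed_preimage[OF kcont, of "- ball 0 1"]
      by (simp add: vimage_def Int_def closed_Compl)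
    moreover have "bounded K"
      by (rule bounded_subset[OF bounded_cball[of 0 "norm z1"]]) (auto simp: K_def)
    ultimately show ?thesis by (simp add: compact_eq_bounded_closed)
  qed
  moreover have "z1 \<in> K" using z1 z1_0 by (auto simp: K_def k_def norm_divide divide_simps)
  ultimately obtain z0 where z0: "z0 \<in> K" "\<And>z. z \<in> K \<Longrightarrow> norm z0 \<le> norm z"
    using continuous_attains_inf[of K norm] continuous_on_norm_id by blast
  have z0_0: "z0 \<noteq> 0" using z0 small by (auto simp: K_def k_def)
  have z0z1: "norm z0 \<le> norm z1" and k1: "norm (k z0) \<ge> 1" using z0 by (auto simp: K_def)
  have less: "norm (k z) < 1" if "norm z < norm z0" for z
    using that z0(2)[of z] z0z1 by (auto simp: K_def)
  \<comment> \<open>On the closed disc: a point with \<open>\<bar>k\<bar> > 1\<close> has such points on its radius, strictly closer to \<open>0\<close>.\<close>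
  have le: "norm (k z) \<le> 1" if "norm z \<le> norm z0" for z
  proof (rule ccontr)
    assume "\<not> norm (k z) \<le> 1"
    moreover have "isCont (\<lambda>t. norm (k (of_real t * z))) 1"
    proof -
      have "z \<in> ball 0 s" using that z0z1 z1 by auto
      then have "isCont k z"
        using holomorphic_on_imp_continuous_on[OF khol] continuous_on_eq_continuous_at[OF open_ball]
        by blast
      then have "isCont (\<lambda>t. k (of_real t * z)) (1::real)"
        by (intro continuous_at_compose[of 1 "\<lambda>t. of_real t * z" k, unfolded o_def])
           (auto intro!: continuous_intros)
      then show ?thesis by (rule continuous_norm)
    qed
    ultimately have "eventually (\<lambda>t. norm (k (of_real t * z)) > 1) (at (1::real))"
      by (intro order_tendstoD[where y = "norm (k z)"]) (auto simp: isCont_def)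
    then have "eventually (\<lambda>t. norm (k (of_real t * z)) > 1) (at_left (1::real))"
      by (rule filter_leD[rotated]) (simp add: at_le)
    moreover have "eventually (\<lambda>t. t \<in> {0<..<1}) (at_left (1::real))"
      by (rule eventually_at_left_real) simp
    ultimately have "eventually (\<lambda>t. norm (k (of_real t * z)) > 1 \<and> t \<in> {0<..<1}) (at_left (1::real))"
      by (rule eventually_conj)
    then obtain t where t: "norm (k (of_real t * z)) > 1" "0 < t" "t < 1"
      using eventually_happens[of _ "at_left (1::real)"] by (auto simp: trivial_limit_at_left_real)
    have "z \<noteq> 0" using less[of 0] \<open>\<not> norm (k z) \<le> 1\<close> z0_0 by auto
    then have "norm (of_real t * z) < norm z0"
      using t that less_le_trans[OF mult_strict_right_mono[of t 1 "norm z"], of "norm z0"]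
      by (simp add: norm_mult)
    from less[OF this] t show False by simp
  qed
  have kz0: "norm (k z0) = 1" using k1 le[of z0] by simp
  then have kz0_0: "k z0 \<noteq> 0" by auto
  \<comment> \<open>Normalised so that \<open>Re h\<close>, and not just \<open>\<bar>h\<bar>\<close>, has its maximum over the disc at \<open>z0\<close>.\<close>
  define h where "h z = k z / k z0" for z
  have z0s: "z0 \<in> ball 0 s" using z0z1 z1 by auto
  have kder: "(k has_field_derivative deriv k z0) (at z0)"
    by (rule holomorphic_derivI[OF khol _ z0s]) simp
  define l where "l = deriv k z0 / k z0"
  have hder: "(h has_field_derivative l) (at z0)"
    unfolding h_def l_def by (rule DERIV_cdivide[OF kder])
  have h1: "h z0 = 1" using kz0_0 by (simp add: h_def)
  have hle: "Re (h z) \<le> 1" if "norm z \<le> norm z0" for z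
    using complex_Re_le_cmod[of "h z"] le[OF that] kz0 by (simp add: h_def norm_divide)
  have "Im (z0 * l) = 0"
  proof -
    have "((\<lambda>t. exp (\<i> * of_real t)) has_vector_derivative \<i>) (at (0::real))"
      by (intro has_vector_derivative_real_field[of "\<lambda>t. exp (\<i> * t)"])
         (auto intro!: derivative_eq_intros)
    then have cis: "(cis has_vector_derivative \<i>) (at 0)" by (simp add: cis_conv_exp[abs_def])
    have "((\<lambda>t. h (z0 * cis t)) has_vector_derivative (z0 * (\<i> * cis 0)) * l) (at (0::real))"
      using hder
      by (intro field_vector_diff_chain_at[of "\<lambda>t. z0 * cis t" _ 0 h, unfolded o_def])
         (auto intro!: derivative_eq_intros cis)
    then have "((\<lambda>t. Re (h (z0 * cis t))) has_vector_derivative Re (z0 * \<i> * l)) (at (0::real))"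
      by (auto dest: bounded_linear.has_vector_derivative[OF bounded_linear_Re] simp: mult_ac)
    then have "((\<lambda>t. Re (h (z0 * cis t))) has_real_derivative Re (z0 * \<i> * l)) (at (0::real))"
      by (simp add: has_real_derivative_iff_has_vector_derivative)
    from DERIV_local_max[OF this zero_less_one] have "Re (z0 * \<i> * l) = 0"
      using hle[of "z0 * cis _"] by (simp add: norm_mult h1)
    then show ?thesis by (simp add: algebra_simps)
  qed
  moreover have "Re (z0 * l) \<ge> 0"
  proof (rule ccontr)
    assume neg: "\<not> Re (z0 * l) \<ge> 0"
    have "((\<lambda>t. h (of_real t * z0)) has_vector_derivative z0 * l) (at (1::real))"
      using hder
      by (intro field_vector_diff_chain_at[of "\<lambda>t. of_real t * z0" _ 1 h, unfolded o_def])
         (auto intro!: derivative_eq_intros)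
    then have "((\<lambda>t. Re (h (of_real t * z0))) has_real_derivative Re (z0 * l)) (at (1::real))"
      by (auto dest: bounded_linear.has_vector_derivative[OF bounded_linear_Re] simp: has_real_derivative_iff_has_vector_derivative)
    from DERIV_neg_dec_left[OF this] neg obtain d where
      d: "d > 0" "\<And>x. 0 < x \<Longrightarrow> x < d \<Longrightarrow> Re (h z0) < Re (h (of_real (1 - x) * z0))"
      by auto
    define x where "x = min (d/2) 1"
    have x: "0 < x" "x < d" "x \<le> 1" using d by (auto simp: x_def)
    have "norm (of_real (1 - x) * z0) \<le> norm z0"
      unfolding norm_mult norm_of_real using x by (intro mult_left_le_one_le) auto
    from hle[OF this] d(2)[OF x(1,2)] h1 show False by simp
  qed
  ultimately obtain a where a: "a \<ge> 0" "z0 * l = of_real a"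
    by (metis complex_eq_iff Re_complex_of_real Im_complex_of_real)
  have "(\<omega> has_field_derivative k z0 + z0 * deriv k z0) (at z0)"
    unfolding omega_eq[abs_def] using kder by (auto intro!: derivative_eq_intros)
  then have "z0 * deriv \<omega> z0 = z0 * (k z0 + z0 * deriv k z0)"
    using DERIV_imp_deriv by metis
  also have "\<dots> = (1 + z0 * l) * \<omega> z0"
    using kz0_0 by (simp add: l_def omega_eq field_simps)
  also have "\<dots> = of_real (1 + a) * \<omega> z0" using a by simp
  finally have "z0 * deriv \<omega> z0 = of_real (1 + a) * \<omega> z0" .
  moreover have "norm (\<omega> z0) = norm z0" by (simp add: omega_eq norm_mult kz0)
  ultimately show ?thesis using that[of z0 "1 + a"] z0_0 z0z1 a by simp
qed

section \<open>Continuation of lifts through a locally univalent function\<close>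

text \<open>
  The gain over the inverse function theorem is that the two radii do not depend on the point of the compact
  set: the first comes from a Lebesgue number of the cover by sets of injectivity, the second is the least
  value of \<open>\<bar>Q (\<zeta> + u) - Q \<zeta>\<bar>\<close> over the compact set of \<open>\<zeta>\<close> and \<open>\<bar>u\<bar> = d\<close>. Injectivity is asked on
  the ball of twice the radius so that balls of radius \<open>d\<close> around nearby points fit into one of its kind.
\<close>

lemma uniform_local_inverse:
  fixes Q :: "complex \<Rightarrow> complex"
  assumes hol: "Q holomorphic_on S" and S: "open S"
    and der: "\<And>z. z \<in> S \<Longrightarrow> deriv Q z \<noteq> 0"
    and K: "compact K" "K \<subseteq> S"
  shows "\<exists>d>0. \<exists>\<epsilon>>0. \<forall>\<zeta>\<in>K. ball \<zeta> (2 * d) \<subseteq> S \<and> inj_on Q (ball \<zeta> (2 * d)) \<and>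
           ball (Q \<zeta>) \<epsilon> \<subseteq> Q ` ball \<zeta> d"
proof -
  define \<G> where "\<G> = {U. open U \<and> U \<subseteq> S \<and> inj_on Q U}"
  have "K \<subseteq> \<Union>\<G>"
  proof
    fix x assume "x \<in> K"
    with K have x: "x \<in> S" by auto
    obtain r where "r > 0" "ball x r \<subseteq> S" "inj_on Q (ball x r)"
      by (rule has_complex_derivative_locally_injective[OF hol x S der[OF x]])
    then show "x \<in> \<Union>\<G>" by (intro UnionI[of "ball x r"]) (auto simp: \<G>_def)
  qed
  moreover have "\<And>G. G \<in> \<G> \<Longrightarrow> open G" by (simp add: \<G>_def)
  ultimately obtain \<eta> where \<eta>: "\<eta> > 0" "\<And>x. x \<in> K \<Longrightarrow> \<exists>G\<in>\<G>. ball x \<eta> \<subseteq> G"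
    using Heine_Borel_lemma[OF K(1)] by metis
  define d where "d = \<eta> / 2"
  have d: "d > 0" using \<eta> by (simp add: d_def)
  have sub: "ball \<zeta> (2 * d) \<subseteq> S" and inj: "inj_on Q (ball \<zeta> (2 * d))" if "\<zeta> \<in> K" for \<zeta>
    using \<eta>(2)[OF that] by (auto simp: \<G>_def d_def intro: inj_on_subset)
  define F where "F p = norm (Q (fst p + snd p) - Q (fst p))" for p :: "complex \<times> complex"
  have inball: "\<zeta> + u \<in> ball \<zeta> (2 * d)" if "u \<in> sphere (0::complex) d" for \<zeta> u :: complex
    using that d by (simp add: dist_norm)
  have "continuous_on (K \<times> sphere (0::complex) d) F"
    unfolding F_def
  proof (intro continuous_on_norm continuous_on_diff)
    have "fst p + snd p \<in> S" if "p \<in> K \<times> sphere (0::complex) d" for p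
      using sub inball that by (metis SigmaE fst_conv snd_conv subsetD)
    then show "continuous_on (K \<times> sphere (0::complex) d) (\<lambda>p. Q (fst p + snd p))"
      by (intro continuous_on_compose2[OF holomorphic_on_imp_continuous_on[OF hol], of _ "\<lambda>p. fst p + snd p"]
          continuous_intros) blast
    show "continuous_on (K \<times> sphere (0::complex) d) (\<lambda>p. Q (fst p))"
      by (intro continuous_on_compose2[OF holomorphic_on_imp_continuous_on[OF hol], of _ fst]
          continuous_intros) (use K in auto)
  qed
  moreover have "compact (K \<times> sphere (0::complex) d)" using K by (intro compact_Times) auto
  ultimately obtain \<epsilon> where \<epsilon>: "\<epsilon> > 0" "\<And>p. p \<in> K \<times> sphere (0::complex) d \<Longrightarrow> \<epsilon> \<le> F p"
  proof (cases "K \<times> sphere (0::complex) d = {}")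
    case False
    assume "continuous_on (K \<times> sphere (0::complex) d) F" "compact (K \<times> sphere (0::complex) d)"
    then obtain p where p: "p \<in> K \<times> sphere (0::complex) d" "\<And>p'. p' \<in> K \<times> sphere (0::complex) d \<Longrightarrow> F p \<le> F p'"
      using continuous_attains_inf[of "K \<times> sphere (0::complex) d" F] False by metis
    obtain \<zeta> u where pe: "p = (\<zeta>, u)" "\<zeta> \<in> K" "u \<in> sphere (0::complex) d" using p by auto
    have "Q (\<zeta> + u) \<noteq> Q \<zeta>"
      using inj_onD[OF inj[OF pe(2)] _ inball[OF pe(3)], of \<zeta>] pe d by auto
    then show ?thesis using that[of "F p"] p by (simp add: F_def pe)
  qed (use that[of 1] in auto)
  have "ball (Q \<zeta>) \<epsilon> \<subseteq> Q ` ball \<zeta> d" if \<zeta>: "\<zeta> \<in> K" for \<zeta>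
  proof (rule ball_subset_open_map_image)
    have "cball \<zeta> d \<subseteq> ball \<zeta> (2 * d)" using d by auto
    then show "continuous_on (closure (ball \<zeta> d)) Q"
      using d sub[OF \<zeta>] by (intro holomorphic_on_imp_continuous_on holomorphic_on_subset[OF hol]) auto
    have "ball \<zeta> d \<subseteq> ball \<zeta> (2 * d)" using d by auto
    then show "open (Q ` interior (ball \<zeta> d))"
      using sub[OF \<zeta>] inj[OF \<zeta>]
      by (auto intro!: open_mapping_thm3 holomorphic_on_subset[OF hol] intro: inj_on_subset)
    show "\<epsilon> \<le> norm (Q z - Q \<zeta>)" if "z \<in> frontier (ball \<zeta> d)" for z
      using \<epsilon>(2)[of "(\<zeta>, z - \<zeta>)"] \<zeta> that d by (simp add: F_def dist_norm norm_minus_commute)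
  qed (use d \<epsilon> in auto)
  with sub inj have "\<forall>\<zeta>\<in>K. ball \<zeta> (2 * d) \<subseteq> S \<and> inj_on Q (ball \<zeta> (2 * d)) \<and>
      ball (Q \<zeta>) \<epsilon> \<subseteq> Q ` ball \<zeta> d" by simp
  then show ?thesis using d \<epsilon>(1) by metis
qed

text \<open>
  A lift of \<open>q\<close> through \<open>Q\<close> on the disc of radius \<open>s\<close>. It is required to take values in the disc of
  radius \<open>R\<close>, where \<open>Q\<close> is under control.
\<close>

definition centred_lift ::
  "(complex \<Rightarrow> complex) \<Rightarrow> real \<Rightarrow> (complex \<Rightarrow> complex) \<Rightarrow> real \<Rightarrow> (complex \<Rightarrow> complex) \<Rightarrow> bool" where
  "centred_lift Q R q s \<omega> \<longleftrightarrow>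
     \<omega> holomorphic_on ball 0 s \<and> \<omega> 0 = 0 \<and>
     (\<forall>z\<in>ball 0 s. \<omega> z \<in> ball 0 R \<and> Q (\<omega> z) = q z)"

text \<open>
  A continuous \<open>c\<close> for which \<open>Q \<circ> c\<close> is uniformly close to \<open>q\<close> can be corrected to an exact lift:
  near \<open>c z\<close> there is exactly one solution \<open>\<xi>\<close> of \<open>Q \<xi> = q z\<close>. The correction is analytic, although \<open>c\<close> is
  only continuous, because locally it is an inverse branch of \<open>Q\<close> applied to \<open>q\<close>.
\<close>

lemma centred_lift_near_approximation:
  assumes hol: "Q holomorphic_on ball 0 R" and qhol: "q holomorphic_on ball 0 s"
    and start: "q 0 = Q 0" and s: "0 < s" and d: "d > 0"
    and sub: "\<And>\<zeta>. \<zeta> \<in> K \<Longrightarrow> ball \<zeta> (2 * d) \<subseteq> ball 0 R"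
    and inj: "\<And>\<zeta>. \<zeta> \<in> K \<Longrightarrow> inj_on Q (ball \<zeta> (2 * d))"
    and surj: "\<And>\<zeta>. \<zeta> \<in> K \<Longrightarrow> ball (Q \<zeta>) \<epsilon> \<subseteq> Q ` ball \<zeta> d"
    and c: "continuous_on (ball 0 s) c" "c 0 = 0" "\<And>z. z \<in> ball 0 s \<Longrightarrow> c z \<in> K"
    and near: "\<And>z. z \<in> ball 0 s \<Longrightarrow> dist (Q (c z)) (q z) < \<epsilon>"
  shows "\<exists>\<Omega>. centred_lift Q R q s \<Omega>"
proof -
  define \<Omega> where "\<Omega> z = (SOME \<xi>. \<xi> \<in> ball (c z) d \<and> Q \<xi> = q z)" for z
  have \<Omega>: "\<Omega> z \<in> ball (c z) d" "Q (\<Omega> z) = q z" if z: "z \<in> ball 0 s" for z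
  proof -
    have "q z \<in> Q ` ball (c z) d" using surj[OF c(3)[OF z]] near[OF z] by auto
    then have "\<exists>\<xi>. \<xi> \<in> ball (c z) d \<and> Q \<xi> = q z" by auto
    from someI_ex[OF this] show "\<Omega> z \<in> ball (c z) d" "Q (\<Omega> z) = q z"
      unfolding \<Omega>_def by auto
  qed
  have dbl: "ball x d \<subseteq> ball x (2 * d)" for x :: complex using d by auto
  have s0: "(0::complex) \<in> ball 0 s" using s by simp
  have "\<Omega> 0 = 0"
    using inj_onD[OF inj[OF c(3)[OF s0]], of "\<Omega> 0" 0] \<Omega>[OF s0] start d c(2) by auto
  moreover have "\<Omega> z \<in> ball 0 R" if "z \<in> ball 0 s" for z
    using \<Omega>(1)[OF that] sub[OF c(3)[OF that]] dbl[of "c z"] by blast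
  moreover have "\<Omega> holomorphic_on ball 0 s"
  proof (subst holomorphic_on_open[OF open_ball], intro ballI)
    fix z0 :: complex assume z0: "z0 \<in> ball 0 s"
    let ?B = "ball (c z0) (2 * d)"
    obtain g where g: "g holomorphic_on (Q ` ?B)" "\<And>z. z \<in> ?B \<Longrightarrow> g (Q z) = z"
      using holomorphic_has_inverse[OF holomorphic_on_subset[OF hol sub[OF c(3)[OF z0]]] open_ball
          inj[OF c(3)[OF z0]]] by metis
    define N where "N = ball 0 s \<inter> c -` ball (c z0) d"
    have N: "open N" "N \<subseteq> ball 0 s" unfolding N_def
      using continuous_open_preimage[OF c(1) open_ball open_ball] by auto
    have z0N: "z0 \<in> N" using z0 d by (simp add: N_def)
    have inB: "\<Omega> z \<in> ?B" if "z \<in> N" for z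
      using that \<Omega>(1)[of z] dist_triangle[of "c z0" "\<Omega> z" "c z"] by (auto simp: N_def)
    have "(\<lambda>z. g (q z)) holomorphic_on N"
    proof (rule holomorphic_on_compose_gen[OF _ g(1), of q N, unfolded o_def])
      show "q holomorphic_on N" using qhol N(2) by (rule holomorphic_on_subset)
      show "q ` N \<subseteq> Q ` ?B"
      proof
        fix y assume "y \<in> q ` N"
        then obtain z where "z \<in> N" "y = q z" by auto
        then show "y \<in> Q ` ?B" using \<Omega>(2)[of z] inB[of z] N(2) by (intro image_eqI[of _ _ "\<Omega> z"]) auto
      qed
    qed
    moreover have "g (q z) = \<Omega> z" if "z \<in> N" for z
      using g(2)[OF inB[OF that]] \<Omega>(2)[of z] that N(2) by auto
    ultimately have "\<Omega> holomorphic_on N" by (rule holomorphic_transform)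
    then show "\<exists>f'. (\<Omega> has_field_derivative f') (at z0)"
      using N(1) z0N holomorphic_derivI by blast
  qed
  ultimately show ?thesis unfolding centred_lift_def using \<Omega>(2) by blast
qed

text \<open>
  Continuation of the germ at \<open>0\<close>. Given a lift \<open>\<omega>\<close> on a disc, its dilation \<open>\<omega> (z / \<kappa>)\<close> with \<open>\<kappa> > 1\<close>
  lives on a larger disc and is an approximate lift, since \<open>q (z / \<kappa>)\<close> is close to \<open>q z\<close>; correcting it
  gives a lift on the larger disc. The a priori bound keeps all lifts
  inside the closed disc of radius \<open>a\<close>, so the same \<open>\<kappa>\<close> serves at every step and finitely many steps reach radius \<open>a\<close>.
\<close>

lemma centred_lift_exists:
  assumes hol: "Q holomorphic_on ball 0 R"
    and der: "\<And>z. z \<in> ball 0 R \<Longrightarrow> deriv Q z \<noteq> 0"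
    and qhol: "q holomorphic_on ball 0 R" and start: "q 0 = Q 0" and a: "0 < a" "a < R"
    and bound: "\<And>s \<omega> z. 0 < s \<Longrightarrow> s \<le> a \<Longrightarrow> centred_lift Q R q s \<omega> \<Longrightarrow> z \<in> ball 0 s
                 \<Longrightarrow> norm (\<omega> z) \<le> norm z"
  shows "\<exists>\<omega>. centred_lift Q R q a \<omega>"
proof -
  have K: "compact (cball (0::complex) a)" "cball (0::complex) a \<subseteq> ball 0 R" using a by auto
  obtain d \<epsilon> where d: "d > 0" "\<epsilon> > 0" and loc: "\<forall>\<zeta>\<in>cball 0 a.
      ball \<zeta> (2 * d) \<subseteq> ball 0 R \<and> inj_on Q (ball \<zeta> (2 * d)) \<and> ball (Q \<zeta>) \<epsilon> \<subseteq> Q ` ball \<zeta> d"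
    using uniform_local_inverse[OF hol open_ball der K] by blast
  have correct: "\<exists>\<Omega>. centred_lift Q R q s \<Omega>"
    if "0 < s" "s \<le> a" "continuous_on (ball 0 s) c" "c 0 = 0"
      "\<And>z. z \<in> ball 0 s \<Longrightarrow> c z \<in> cball 0 a"
      "\<And>z. z \<in> ball 0 s \<Longrightarrow> dist (Q (c z)) (q z) < \<epsilon>" for s c
  proof (rule centred_lift_near_approximation[OF hol _ start that(1) d(1) _ _ _ that(3-6)])
    show "q holomorphic_on ball 0 s"
      by (rule holomorphic_on_subset[OF qhol]) (use that(2) a in auto)
  qed (use loc in blast)+
  have "uniformly_continuous_on (cball 0 a) q"
    using K by (intro compact_uniformly_continuous holomorphic_on_imp_continuous_on
        holomorphic_on_subset[OF qhol]) auto
  then obtain \<eta> where \<eta>: "\<eta> > 0"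
    "\<And>x y. x \<in> cball 0 a \<Longrightarrow> y \<in> cball 0 a \<Longrightarrow> dist x y < \<eta> \<Longrightarrow> dist (q x) (q y) < \<epsilon>"
    using d(2) unfolding uniformly_continuous_on_def by metis
  define s0 where "s0 = min \<eta> a"
  \<comment> \<open>Chosen so that \<open>z / \<kappa>\<close> and \<open>z\<close> differ by less than \<open>\<eta>\<close> when \<open>\<bar>z\<bar> < a\<close>.\<close>
  define \<kappa> where "\<kappa> = 1 + \<eta> / (2 * a)"
  have s0: "0 < s0" "s0 \<le> a" using \<eta> a by (auto simp: s0_def)
  have \<kappa>: "\<kappa> > 1" using \<eta> a by (simp add: \<kappa>_def)
  have "\<exists>\<omega>. centred_lift Q R q (min (\<kappa> ^ n * s0) a) \<omega>" for n
  proof (induction n)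
    case 0
    have "dist (q 0) (q z) < \<epsilon>" if "z \<in> ball 0 s0" for z
      using that by (intro \<eta>(2)) (use a in \<open>auto simp: s0_def\<close>)
    \<comment> \<open>On a small disc the constant \<open>0\<close> is an approximate lift.\<close>
    then show ?case using s0 start a by (intro correct[of _ "\<lambda>_. 0"]) auto
  next
    case (Suc n)
    define s where "s = min (\<kappa> ^ n * s0) a"
    define s' where "s' = min (\<kappa> ^ Suc n * s0) a"
    obtain \<omega> where lift: "centred_lift Q R q s \<omega>" using Suc by (auto simp: s_def)
    have s: "0 < s" "s \<le> a" using s0 \<kappa> a by (auto simp: s_def)
    have s': "0 < s'" "s' \<le> a" using s0 \<kappa> a by (auto simp: s'_def)
    have "s' \<le> \<kappa> * s"
    proof -
      have "s' \<le> min (\<kappa> * (\<kappa> ^ n * s0)) (\<kappa> * a)"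
        using \<kappa> a by (simp add: s'_def min.coboundedI2 mult.assoc)
      also have "\<dots> = \<kappa> * s" using \<kappa> by (simp add: s_def min_mult_distrib_left)
      finally show ?thesis .
    qed
    then have small: "z / of_real \<kappa> \<in> ball 0 s" if "z \<in> ball 0 s'" for z :: complex
      using that \<kappa> by (simp add: norm_divide divide_simps mult.commute)
    have \<omega>: "\<omega> holomorphic_on ball 0 s" "\<omega> 0 = 0" "\<And>z. z \<in> ball 0 s \<Longrightarrow> Q (\<omega> z) = q z"
      using lift by (auto simp: centred_lift_def)
    have "\<exists>\<Omega>. centred_lift Q R q s' \<Omega>"
    proof (rule correct[OF s', of "\<lambda>z. \<omega> (z / of_real \<kappa>)"])
      show "continuous_on (ball 0 s') (\<lambda>z. \<omega> (z / of_real \<kappa>))"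
        by (rule continuous_on_compose2[OF holomorphic_on_imp_continuous_on[OF \<omega>(1)]])
           (use small \<kappa> in \<open>auto intro!: continuous_intros\<close>)
      fix z :: complex assume z: "z \<in> ball 0 s'"
      have "norm (\<omega> (z / of_real \<kappa>)) \<le> norm (z / of_real \<kappa>)"
        by (rule bound[OF s lift small[OF z]])
      then show "\<omega> (z / of_real \<kappa>) \<in> cball 0 a" using small[OF z] s by auto
      have "z - z / of_real \<kappa> = of_real (1 - 1 / \<kappa>) * z" by (simp add: algebra_simps)
      then have "dist z (z / of_real \<kappa>) = \<bar>1 - 1 / \<kappa>\<bar> * norm z"
        by (simp only: dist_norm norm_mult norm_of_real)
      then have "dist (z / of_real \<kappa>) z = (1 - 1 / \<kappa>) * norm z"
        using \<kappa> by (simp add: dist_commute)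
      also have "\<dots> \<le> (\<kappa> - 1) * a"
      proof (intro mult_mono)
        show "1 - 1 / \<kappa> \<le> \<kappa> - 1"
          using \<kappa> zero_le_square[of "\<kappa> - 1"] by (simp add: field_simps)
      qed (use z s' \<kappa> in auto)
      also have "\<dots> < \<eta>" using \<eta> a by (simp add: \<kappa>_def)
      finally have "dist (z / of_real \<kappa>) z < \<eta>" .
      then have "dist (q (z / of_real \<kappa>)) (q z) < \<epsilon>"
        using small[OF z] z s s' by (intro \<eta>(2)) auto
      then show "dist (Q (\<omega> (z / of_real \<kappa>))) (q z) < \<epsilon>" using \<omega>(3)[OF small[OF z]] by simp
    qed (simp add: \<omega>)
    then show ?case by (simp add: s'_def)
  qed
  moreover obtain n where "a / s0 < \<kappa> ^ n" using real_arch_pow[OF \<kappa>] by blast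
  then have "min (\<kappa> ^ n * s0) a = a" using s0 by (simp add: divide_simps)
  ultimately show ?thesis by metis
qed

text \<open>
  Near \<open>0\<close> both lifts take values where \<open>Q\<close> is injective, so they agree there, hence everywhere.
\<close>

lemma centred_lift_unique:
  assumes hol: "Q holomorphic_on ball 0 R" and R: "0 < R" and der: "deriv Q 0 \<noteq> 0"
    and l1: "centred_lift Q R q s \<omega>\<^sub>1" and l2: "centred_lift Q R q s \<omega>\<^sub>2" and z: "z \<in> ball 0 s"
  shows "\<omega>\<^sub>1 z = \<omega>\<^sub>2 z"
proof -
  have s: "0 < s" using z by (auto intro: le_less_trans[OF norm_ge_zero])
  obtain r where r: "r > 0" "inj_on Q (ball 0 r)"
    using has_complex_derivative_locally_injective[OF hol _ open_ball der] R by auto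
  note h = l1[unfolded centred_lift_def] l2[unfolded centred_lift_def]
  define N where "N = (ball 0 s \<inter> \<omega>\<^sub>1 -` ball 0 r) \<inter> (ball 0 s \<inter> \<omega>\<^sub>2 -` ball 0 r)"
  show ?thesis
  proof (rule analytic_continuation_open[of N "ball 0 s" \<omega>\<^sub>1 \<omega>\<^sub>2])
    show "open N" unfolding N_def
      using h by (intro open_Int continuous_open_preimage holomorphic_on_imp_continuous_on) auto
    have "0 \<in> N" using h s r by (auto simp: N_def)
    then show "N \<noteq> {}" by auto
    show "\<omega>\<^sub>1 w = \<omega>\<^sub>2 w" if w: "w \<in> N" for w
    proof (rule inj_onD[OF r(2)])
      show "Q (\<omega>\<^sub>1 w) = Q (\<omega>\<^sub>2 w)" using w h by (simp add: N_def)
    qed (use w in \<open>simp_all add: N_def\<close>)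
    show "N \<subseteq> ball 0 s" by (auto simp: N_def)
    show "\<omega>\<^sub>1 holomorphic_on ball 0 s" "\<omega>\<^sub>2 holomorphic_on ball 0 s" using h by simp_all
  qed (use z in simp_all)
qed

lemma centred_lift_glue:
  assumes hol: "Q holomorphic_on ball 0 R" and R: "0 < R" and der: "deriv Q 0 \<noteq> 0"
    and ex: "\<And>a. 0 < a \<Longrightarrow> a < R \<Longrightarrow> \<exists>\<omega>. centred_lift Q R q a \<omega>"
  shows "\<exists>\<omega>. centred_lift Q R q R \<omega>"
proof -
  define W where "W a = (SOME \<omega>. centred_lift Q R q a \<omega>)" for a
  have W: "centred_lift Q R q a (W a)" if "0 < a" "a < R" for a
    using someI_ex[OF ex[OF that]] by (simp add: W_def)
  have agree: "W a z = W b z" if "0 < a" "a \<le> b" "b < R" "z \<in> ball 0 a" for a b z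
  proof (rule centred_lift_unique[OF hol R der _ _ that(4)])
    show "centred_lift Q R q a (W a)" using W that by simp
    have "ball 0 a \<subseteq> ball (0::complex) b" using that by auto
    moreover have "centred_lift Q R q b (W b)" using W that by simp
    ultimately show "centred_lift Q R q a (W b)"
      unfolding centred_lift_def by (blast intro: holomorphic_on_subset)
  qed
  define rad where "rad z = (norm z + R) / 2" for z :: complex
  have rad: "0 < rad z" "rad z < R" "z \<in> ball 0 (rad z)" if "z \<in> ball 0 R" for z
    using that R by (auto simp: rad_def intro: add_nonneg_pos)
  define \<omega> where "\<omega> z = W (rad z) z" for z
  have loc: "\<omega> z = W a z" if "0 < a" "a < R" "z \<in> ball 0 a" for a z
  proof -
    have z: "z \<in> ball 0 R" using that by auto
    show ?thesis
    proof (cases "a \<le> rad z")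
      case True
      show ?thesis using agree[OF that(1) True rad(2)[OF z] that(3)] by (simp add: \<omega>_def)
    next
      case False
      show ?thesis
        using agree[OF rad(1)[OF z] _ that(2) rad(3)[OF z]] False by (simp add: \<omega>_def)
    qed
  qed
  have "\<omega> holomorphic_on ball 0 R"
  proof (subst holomorphic_on_open[OF open_ball], intro ballI)
    fix z0 :: complex assume z0: "z0 \<in> ball 0 R"
    have "W (rad z0) holomorphic_on ball 0 (rad z0)"
      using W[OF rad(1,2)[OF z0]] by (simp add: centred_lift_def)
    then have "\<omega> holomorphic_on ball 0 (rad z0)"
      by (rule holomorphic_transform) (use loc[of "rad z0"] rad[OF z0] in auto)
    then show "\<exists>f'. (\<omega> has_field_derivative f') (at z0)"
      using holomorphic_derivI[OF _ open_ball rad(3)[OF z0]] by blast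
  qed
  moreover have "\<omega> z \<in> ball 0 R \<and> Q (\<omega> z) = q z" if "z \<in> ball 0 R" for z
    using W[OF rad(1,2)[OF that]] rad(3)[OF that] by (auto simp: centred_lift_def \<omega>_def)
  moreover have "\<omega> 0 = 0"
    using W[OF rad(1,2)[of 0]] R by (simp add: \<omega>_def centred_lift_def)
  ultimately have "centred_lift Q R q R \<omega>" by (simp add: centred_lift_def)
  then show ?thesis by (rule exI[of _ \<omega>])
qed

section \<open>The half-plane map\<close>

text \<open>
  With \<open>e = rot lam\<close>, the map \<open>P_fun lam\<close> has inverse \<open>W \<mapsto> (W - 1) / (W + e)\<close>. The image of the closed disc
  of radius \<open>\<rho> < 1\<close> is thus described by \<open>\<bar>W - 1\<bar> \<le> \<rho> \<bar>W + e\<bar>\<close>, and this form is used throughout.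
\<close>

abbreviation rot :: "real \<Rightarrow> complex" where
  "rot lam \<equiv> exp (2 * \<i> * of_real lam)"

lemma norm_rot: "norm (rot lam) = 1"
  by (simp add: norm_exp_eq_Re)

lemma one_plus_rot_nonzero:
  assumes "- pi / 2 < lam" "lam < pi / 2"
  shows "1 + rot lam \<noteq> 0"
proof -
  have "cos lam \<noteq> 0" using cos_gt_zero_pi[of lam] assms by simp
  then have "2 * exp (\<i> * of_real lam) * complex_of_real (cos lam) \<noteq> 0"
    unfolding mult_eq_0_iff of_real_eq_0_iff by simp
  then show ?thesis unfolding two_exp_cos by (simp only: add.commute) simp
qed

lemma P_fun_0 [simp]: "P_fun lam 0 = 1"
  by (simp add: P_fun_def)

lemma P_fun_plus_rot: "z \<noteq> 1 \<Longrightarrow> P_fun lam z + rot lam = (1 + rot lam) / (1 - z)"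
  by (simp add: P_fun_def add_divide_eq_iff divide_add_eq_iff algebra_simps)

lemma P_fun_minus_one: "z \<noteq> 1 \<Longrightarrow> P_fun lam z - 1 = z * (P_fun lam z + rot lam)"
proof -
  assume "z \<noteq> 1"
  then have "P_fun lam z * (1 - z) = 1 + rot lam * z" by (simp add: P_fun_def)
  then show ?thesis by (simp add: algebra_simps)
qed

lemma P_fun_nonzero:
  assumes "norm z < 1"
  shows "P_fun lam z \<noteq> 0"
proof
  assume "P_fun lam z = 0"
  then have "rot lam * z = - 1" using assms by (auto simp: P_fun_def eq_neg_iff_add_eq_0 add.commute)
  then have "norm (rot lam * z) = 1" by simp
  then show False using assms by (simp add: norm_mult norm_rot)
qed

lemma P_fun_eq_iff:
  assumes "1 + rot lam \<noteq> 0" "z \<noteq> 1" "w \<noteq> 1"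
  shows "P_fun lam z = P_fun lam w \<longleftrightarrow> z = w"
proof
  assume eq: "P_fun lam z = P_fun lam w"
  have "P_fun lam z + rot lam \<noteq> 0" using assms by (simp add: P_fun_plus_rot)
  moreover have "z * (P_fun lam z + rot lam) = w * (P_fun lam z + rot lam)"
    using P_fun_minus_one[OF assms(2), of lam] P_fun_minus_one[OF assms(3), of lam]
    unfolding eq by (rule trans[OF sym])
  ultimately show "z = w" by simp
qed simp

lemma P_fun_has_derivative:
  assumes "z \<noteq> 1"
  shows "(P_fun lam has_field_derivative (1 + rot lam) / (1 - z)\<^sup>2) (at z)"
proof -
  have "((\<lambda>z. (1 + rot lam * z) / (1 - z)) has_field_derivative
      (rot lam * (1 - z) - (1 + rot lam * z) * (- 1)) / ((1 - z) * (1 - z))) (at z)"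
    by (rule derivative_eq_intros refl)+ (use assms in simp_all)
  also have "rot lam * (1 - z) - (1 + rot lam * z) * (- 1) = 1 + rot lam"
    by (simp add: algebra_simps)
  finally show ?thesis by (simp add: P_fun_def[abs_def] power2_eq_square)
qed

lemma P_fun_holomorphic: "P_fun lam holomorphic_on ball 0 1"
  by (subst holomorphic_on_open) (auto intro!: exI P_fun_has_derivative)

text \<open>
  The function \<open>g W = \<bar>W - 1\<bar>\<^sup>2 - \<rho>\<^sup>2 \<bar>W + e\<bar>\<^sup>2\<close> has leading part \<open>(1 - \<rho>\<^sup>2) \<bar>W\<bar>\<^sup>2\<close>, and
  so is convex when \<open>\<rho> < 1\<close>. The point \<open>B\<close> lies on the segment from \<open>C\<close> to \<open>A\<close>, with positive weight on
  \<open>A\<close>; since \<open>g A < 0\<close> and \<open>g C \<le> 0\<close>, the value \<open>g B = 0\<close> is impossible.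
\<close>

lemma disc_no_outward_ray:
  fixes A B C e :: complex
  assumes \<rho>: "0 \<le> \<rho>" "\<rho> < 1"
    and A: "norm (A - 1) < \<rho> * norm (A + e)"
    and B: "norm (B - 1) = \<rho> * norm (B + e)"
    and C: "norm (C - 1) \<le> \<rho> * norm (C + e)"
    and m: "m \<ge> 1" "A - C = of_real m * (B - C)"
  shows False
proof -
  define t where "t = 1 / m"
  have t: "0 < t" "t \<le> 1" using m by (auto simp: t_def)
  have mt: "of_real t * (of_real m :: complex) = 1"
    using m by (simp add: t_def)
  have "B - C = of_real t * (A - C)"
    by (simp add: m(2) mt flip: mult.assoc)
  then have Beq: "B = (1 - of_real t) * C + of_real t * A"
    by (simp add: algebra_simps)
  define g where "g W = (norm (W - 1))\<^sup>2 - \<rho>\<^sup>2 * (norm (W + e))\<^sup>2" for W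
  have "g B = (1 - t) * g C + t * g A - t * (1 - t) * (1 - \<rho>\<^sup>2) * (norm (A - C))\<^sup>2"
    unfolding g_def Beq cmod_power2 by (simp add: algebra_simps power2_eq_square)
  moreover have "g A < 0"
    using A by (simp add: g_def flip: power_mult_distrib) (intro power_strict_mono, auto)
  moreover have "g C \<le> 0"
    using C by (simp add: g_def flip: power_mult_distrib) (intro power_mono, auto)
  moreover have "g B = 0" using B by (simp add: g_def power_mult_distrib)
  moreover have "t * g A < 0" "(1 - t) * g C \<le> 0"
    using calculation t by (auto intro: mult_pos_neg mult_nonneg_nonpos)
  moreover have "\<rho>\<^sup>2 \<le> 1" using \<rho> by (simp add: power_le_one)
  then have "0 \<le> t * (1 - t) * (1 - \<rho>\<^sup>2) * (norm (A - C))\<^sup>2" using t by simp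
  ultimately show False by linarith
qed

section \<open>The Riccati equation and its distinguished solution\<close>

text \<open>
  Compare the derivatives at \<open>0\<close> of the two sides of the equation. This fixes the derivative of a lift at \<open>0\<close>
  and shows that \<open>Q_fun lam\<close> is not \<open>P_fun lam\<close>.
\<close>

lemma riccati_derivative_at_0:
  assumes hol: "q holomorphic_on ball 0 s" and s: "0 < s" and q0: "q 0 = 1"
    and p: "(p has_field_derivative p') (at 0)"
    and ode: "\<And>z. z \<in> ball 0 s \<Longrightarrow> z * deriv q z = q z * (p z - q z)"
  shows "p' = 2 * deriv q 0"
proof -
  have z0: "(0::complex) \<in> ball 0 s" using s by simp
  have p0: "p 0 = 1" using ode[OF z0] q0 by simp
  have q: "(q has_field_derivative deriv q 0) (at 0)"
    by (rule holomorphic_derivI[OF hol open_ball z0])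
  have q2: "(deriv q has_field_derivative deriv (deriv q) 0) (at 0)"
    by (rule holomorphic_derivI[OF holomorphic_deriv[OF hol open_ball] open_ball z0])
  have "((\<lambda>z. z * deriv q z) has_field_derivative deriv q 0) (at 0)"
    by (rule derivative_eq_intros q2 refl | simp)+
  moreover have "((\<lambda>z. q z * (p z - q z)) has_field_derivative p' - deriv q 0) (at 0)"
    by (rule derivative_eq_intros q p refl | simp add: q0 p0)+
  then have "((\<lambda>z. z * deriv q z) has_field_derivative p' - deriv q 0) (at 0)"
    by (rule has_field_derivative_transform_within_open[OF _ open_ball z0]) (simp add: ode)
  ultimately have "deriv q 0 = p' - deriv q 0" by (rule DERIV_unique)
  then show ?thesis by (simp add: algebra_simps)
qed

lemma f_fun_has_derivative:
  assumes "norm z < 1"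
  shows "(f_fun lam has_field_derivative deriv (f_fun lam) z) (at z)"
proof -
  have "Re z < 1"
    using assms complex_Re_le_cmod[of z] by linarith
  then have nn: "1 - z \<notin> \<real>\<^sub>\<le>\<^sub>0"
    by (auto simp: complex_nonpos_Reals_iff)
  have "(f_fun lam has_field_derivative (1 - z) powr (- rot lam - 1)) (at z)"
    unfolding f_fun_eq[abs_def] using nn by (auto intro!: derivative_eq_intros)
  then show ?thesis by (simp only: deriv_f_fun[OF assms])
qed

lemma deriv_f_fun_has_derivative:
  assumes "norm z < 1"
  shows "(deriv (f_fun lam) has_field_derivative
           deriv (f_fun lam) z * ((1 + rot lam) / (1 - z))) (at z)"
proof -
  have "Re z < 1"
    using assms complex_Re_le_cmod[of z] by linarith
  then have nn: "1 - z \<notin> \<real>\<^sub>\<le>\<^sub>0"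
    by (auto simp: complex_nonpos_Reals_iff)
  have "z \<noteq> 1" using assms by auto
  have "((\<lambda>z. (1 - z) powr a) has_field_derivative (1 - z) powr a * (- a / (1 - z))) (at z)" for a
  proof -
    have "((\<lambda>z. (1 - z) powr a) has_field_derivative a * (1 - z) powr (a - 1) * (- 1)) (at z)"
      using nn by (auto intro!: derivative_eq_intros)
    also have "a * (1 - z) powr (a - 1) * (- 1) = (1 - z) powr a * (- a / (1 - z))"
      using \<open>z \<noteq> 1\<close> by (simp add: powr_diff)
    finally show ?thesis .
  qed
  from this[of "- rot lam - 1"]
  have "((\<lambda>z. (1 - z) powr (- rot lam - 1)) has_field_derivative
      (1 - z) powr (- rot lam - 1) * ((1 + rot lam) / (1 - z))) (at z)"
    by (simp add: add.commute)
  then show ?thesis unfolding deriv_f_fun[OF assms]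
    by (rule has_field_derivative_transform_within_open[of _ _ _ "ball 0 1"])
       (use assms in \<open>auto simp: deriv_f_fun\<close>)
qed

lemma Q_fun_has_derivative:
  assumes z: "norm z < 1" "z \<noteq> 0" and f: "f_fun lam z \<noteq> 0"
  shows "(Q_fun lam has_field_derivative Q_fun lam z * (P_fun lam z - Q_fun lam z) / z) (at z)"
proof -
  have "((\<lambda>z. z * deriv (f_fun lam) z / f_fun lam z) has_field_derivative
      Q_fun lam z * (P_fun lam z - Q_fun lam z) / z) (at z)"
  proof (rule derivative_eq_intros f_fun_has_derivative deriv_f_fun_has_derivative z f refl)+
    have "z \<noteq> 1" using z by auto
    then show "((1 * deriv (f_fun lam) z + deriv (f_fun lam) z * ((1 + rot lam) / (1 - z)) * z) * f_fun lam z -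
          z * deriv (f_fun lam) z * deriv (f_fun lam) z) / (f_fun lam z * f_fun lam z) =
          Q_fun lam z * (P_fun lam z - Q_fun lam z) / z"
      using z f by (simp add: Q_fun_def P_fun_def divide_simps) (simp add: algebra_simps)
  qed
  then show ?thesis
    by (rule has_field_derivative_transform_within_open[of _ _ _ "ball 0 1 - {0}"])
       (use z in \<open>auto simp: Q_fun_def\<close>)
qed

lemma Q_fun_0 [simp]: "Q_fun lam 0 = 1"
  by (simp add: Q_fun_def)

text \<open>
  The hypothesis excludes zeros of \<open>f_fun lam\<close> other than \<open>0\<close>: at such a point the quotient
  defining \<open>Q_fun lam\<close> has the value \<open>0\<close>, by the convention on division by zero.
\<close>

lemma Q_fun_riccati:
  assumes z: "norm z < 1" and nz: "Q_fun lam z \<noteq> 0"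
  shows "z * deriv (Q_fun lam) z = Q_fun lam z * (P_fun lam z - Q_fun lam z)"
proof (cases "z = 0")
  case False
  then have "f_fun lam z \<noteq> 0" using nz by (auto simp: Q_fun_def)
  from DERIV_imp_deriv[OF Q_fun_has_derivative[OF z False this]] False show ?thesis by simp
qed simp

text \<open>
  As \<open>f_fun lam z / z\<close> tends to \<open>1\<close> at the origin, the singularity of \<open>Q_fun lam\<close> there is removable.
  The second nonvanishing condition makes \<open>(Q - 1) / (Q + e)\<close>, the inverse of \<open>P_fun lam\<close> applied to \<open>Q\<close>, analytic.
\<close>

lemma Q_fun_near_0:
  assumes lam: "1 + rot lam \<noteq> 0"
  obtains s where "0 < s" "s < 1" "Q_fun lam holomorphic_on ball 0 s"
    "\<And>z. z \<in> ball 0 s \<Longrightarrow> Q_fun lam z \<noteq> 0 \<and> Q_fun lam z + rot lam \<noteq> 0"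
proof -
  define h where "h z = (if z = 0 then deriv (f_fun lam) 0 else f_fun lam z / z)" for z
  have fhol: "f_fun lam holomorphic_on ball 0 1"
    by (subst holomorphic_on_open) (auto intro!: exI f_fun_has_derivative)
  have f0: "f_fun lam 0 = 0" by (simp add: f_fun_def)
  have d0: "deriv (f_fun lam) 0 = 1" by (subst deriv_f_fun) auto
  have hhol: "h holomorphic_on ball 0 1"
    by (rule pole_theorem_open_0[OF fhol, where a = 0]) (auto simp: h_def f0)
  define A where "A = ball 0 1 \<inter> h -` (- {0})"
  have A: "open A" "A \<subseteq> ball 0 1" unfolding A_def
    using hhol by (auto intro!: continuous_open_preimage holomorphic_on_imp_continuous_on)
  have Qeq: "Q_fun lam z = deriv (f_fun lam) z / h z" for z
    by (simp add: Q_fun_def h_def d0)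
  have "(\<lambda>z. deriv (f_fun lam) z / h z) holomorphic_on A"
    using A by (intro holomorphic_on_divide holomorphic_on_subset[OF hhol]
        holomorphic_on_subset[OF holomorphic_deriv[OF fhol open_ball]]) (auto simp: A_def)
  then have Qhol: "Q_fun lam holomorphic_on A" by (simp add: Qeq[abs_def])
  define B where "B = A \<inter> Q_fun lam -` (- {0, - rot lam})"
  have "open B" unfolding B_def
    using A Qhol by (intro continuous_open_preimage holomorphic_on_imp_continuous_on)
      (auto intro!: open_Compl)
  moreover have "0 \<in> B" using lam
    by (auto simp: B_def A_def h_def d0 eq_neg_iff_add_eq_0)
  ultimately obtain t where t: "t > 0" "ball 0 t \<subseteq> B" by (metis open_contains_ball)
  show ?thesis
  proof (rule that[of "min t (1/2)"])
    have sub: "ball 0 (min t (1/2)) \<subseteq> B" using t by auto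
    then show "Q_fun lam holomorphic_on ball 0 (min t (1/2))"
      by (intro holomorphic_on_subset[OF Qhol]) (auto simp: B_def)
    show "Q_fun lam z \<noteq> 0 \<and> Q_fun lam z + rot lam \<noteq> 0" if "z \<in> ball 0 (min t (1/2))" for z
      using that sub by (auto simp: B_def eq_neg_iff_add_eq_0)
  qed (use t in auto)
qed

lemma deriv_Q_fun_0:
  assumes lam: "1 + rot lam \<noteq> 0"
  shows "deriv (Q_fun lam) 0 = (1 + rot lam) / 2"
proof -
  obtain s where s: "0 < s" "s < 1" "Q_fun lam holomorphic_on ball 0 s"
    "\<And>z. z \<in> ball 0 s \<Longrightarrow> Q_fun lam z \<noteq> 0 \<and> Q_fun lam z + rot lam \<noteq> 0"
    using Q_fun_near_0[OF lam] by metis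
  have "1 + rot lam = 2 * deriv (Q_fun lam) 0"
  proof (rule riccati_derivative_at_0[OF s(3,1) Q_fun_0])
    show "(P_fun lam has_field_derivative 1 + rot lam) (at 0)"
      using P_fun_has_derivative[of 0 lam] by simp
    show "z * deriv (Q_fun lam) z = Q_fun lam z * (P_fun lam z - Q_fun lam z)"
      if "z \<in> ball 0 s" for z
      using s that by (intro Q_fun_riccati) auto
  qed
  then show ?thesis by simp
qed

text \<open>
  The supremum defining \<open>R1 lam\<close> is over a nonempty set: \<open>\<phi>\<close>, the inverse of \<open>P_fun lam\<close> applied to \<open>Q_fun lam\<close>, has
  derivative \<open>1/2\<close> at \<open>0\<close>, so \<open>\<bar>\<phi> z\<bar> \<le> \<bar>z\<bar>\<close> near \<open>0\<close>.
\<close>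

lemma small_radius_subordination:
  assumes lam: "1 + rot lam \<noteq> 0"
  shows "\<exists>r. 0 < r \<and> r < 1 \<and> subordinate_in r (Q_fun lam) (P_fun lam)"
proof -
  obtain s where s: "0 < s" "s < 1" "Q_fun lam holomorphic_on ball 0 s"
    "\<And>z. z \<in> ball 0 s \<Longrightarrow> Q_fun lam z \<noteq> 0 \<and> Q_fun lam z + rot lam \<noteq> 0"
    using Q_fun_near_0[OF lam] by metis
  define \<phi> where "\<phi> z = (Q_fun lam z - 1) / (Q_fun lam z + rot lam)" for z
  have \<phi>hol: "\<phi> holomorphic_on ball 0 s"
    unfolding \<phi>_def using s by (intro holomorphic_intros) auto
  have \<phi>0: "\<phi> 0 = 0" by (simp add: \<phi>_def)
  have Q0: "(Q_fun lam has_field_derivative (1 + rot lam) / 2) (at 0)"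
    using holomorphic_derivI[OF s(3) open_ball, of 0] s(1) by (simp add: deriv_Q_fun_0[OF lam])
  have "(\<phi> has_field_derivative 1 / 2) (at 0)"
    unfolding \<phi>_def[abs_def]
    by (rule derivative_eq_intros Q0 refl)+ (use lam in \<open>simp_all add: divide_simps\<close>)
  then have "((\<lambda>z. norm (\<phi> z / z)) \<longlongrightarrow> norm (1 / 2 :: complex)) (at 0)"
    unfolding has_field_derivative_iff by (intro tendsto_norm) (simp add: \<phi>0)
  then have "eventually (\<lambda>z. norm (\<phi> z / z) < 1) (at 0)"
    by (rule order_tendstoD) (simp add: norm_divide)
  then obtain t where t: "t > 0" "\<And>z. z \<noteq> 0 \<Longrightarrow> dist z 0 < t \<Longrightarrow> norm (\<phi> z / z) < 1"
    unfolding eventually_at by auto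
  define r where "r = min s t"
  have r: "0 < r" "r \<le> s" "r < 1" using s t by (auto simp: r_def)
  have \<phi>le: "norm (\<phi> z) \<le> norm z" if "z \<in> ball 0 r" for z
    using t(2)[of z] that \<phi>0 by (cases "z = 0") (auto simp: r_def norm_divide)
  have scale: "of_real r * z \<in> ball 0 r" if "z \<in> ball 0 1" for z :: complex
    using that r by (simp add: norm_mult)
  have scale_s: "of_real r * z \<in> ball 0 s" if "z \<in> ball 0 1" for z :: complex
    using scale[OF that] r by auto
  have comp: "(\<lambda>z. g (of_real r * z)) holomorphic_on ball 0 1" if "g holomorphic_on ball 0 s" for g
    by (rule holomorphic_on_dilate[OF that]) (use r in simp_all)
  have "(\<lambda>z. Q_fun lam (of_real r * z)) \<prec>\<^sub>s (\<lambda>z. P_fun lam (of_real r * z))"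
    unfolding subordinate_def
  proof (intro conjI exI[of _ "\<lambda>z. \<phi> (of_real r * z) / of_real r"] ballI)
    show "(\<lambda>z. Q_fun lam (of_real r * z)) holomorphic_on ball 0 1" by (rule comp[OF s(3)])
    have "P_fun lam holomorphic_on ball 0 s"
      by (rule holomorphic_on_subset[OF P_fun_holomorphic]) (use s in auto)
    then show "(\<lambda>z. P_fun lam (of_real r * z)) holomorphic_on ball 0 1" by (rule comp)
    show "(\<lambda>z. \<phi> (of_real r * z) / of_real r) holomorphic_on ball 0 1"
      using comp[OF \<phi>hol] r by (intro holomorphic_on_divide) auto
    fix z :: complex assume z: "z \<in> ball 0 1"
    have "norm (\<phi> (of_real r * z)) \<le> r * norm z"
      using \<phi>le[OF scale[OF z]] r by (simp add: norm_mult)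
    also have "\<dots> < r" using r z by simp
    finally show "norm (\<phi> (of_real r * z) / of_real r) < 1" using r by (simp add: norm_divide)
    define W where "W = Q_fun lam (of_real r * z)"
    have "W + rot lam \<noteq> 0" using s(4)[OF scale_s[OF z]] by (simp add: W_def)
    then have "P_fun lam ((W - 1) / (W + rot lam)) = ((W + rot lam) + rot lam * (W - 1)) / ((W + rot lam) - (W - 1))"
      by (simp add: P_fun_def divide_simps)
    also have "\<dots> = W * (1 + rot lam) / (1 + rot lam)" by (simp add: algebra_simps)
    also have "\<dots> = W" using lam by simp
    finally show "Q_fun lam (of_real r * z) = P_fun lam (of_real r * (\<phi> (of_real r * z) / of_real r))"
      using r by (simp add: W_def \<phi>_def)
  qed (simp add: \<phi>0)
  then show ?thesis using r unfolding subordinate_in_def by blast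
qed

section \<open>The disc of radius R1\<close>

text \<open>
  Subordination in a disc of radius \<open>r\<close>, expressed on that disc itself and combined with the Schwarz lemma
  for the rescaled factor. The fourth property is its rigidity part.
\<close>

lemma subordinate_in_Schwarz_factor:
  assumes sub: "subordinate_in r F G" and r: "0 < r"
  obtains \<phi> where "\<phi> holomorphic_on ball 0 r" "\<And>z. z \<in> ball 0 r \<Longrightarrow> F z = G (\<phi> z)"
    "\<And>z. z \<in> ball 0 r \<Longrightarrow> norm (\<phi> z) \<le> norm z"
    "\<And>z0. z0 \<in> ball 0 r \<Longrightarrow> z0 \<noteq> 0 \<Longrightarrow> \<phi> z0 = z0 \<Longrightarrow> \<forall>z\<in>ball 0 r. \<phi> z = z"
    "F holomorphic_on ball 0 r"
proof -
  obtain w where w: "w holomorphic_on ball 0 1" "w 0 = 0"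
    "\<And>z. z \<in> ball 0 1 \<Longrightarrow> norm (w z) < 1"
    "\<And>z. z \<in> ball 0 1 \<Longrightarrow> F (of_real r * z) = G (of_real r * w z)"
    and Fr: "(\<lambda>z. F (of_real r * z)) holomorphic_on ball 0 1"
    using sub unfolding subordinate_in_def subordinate_def by blast
  have scale: "z / of_real r \<in> ball 0 1" if "z \<in> ball 0 r" for z :: complex
    using that r by (simp add: norm_divide)
  have comp: "(\<lambda>z. g (z / of_real r)) holomorphic_on ball 0 r" if "g holomorphic_on ball 0 1" for g
    by (rule holomorphic_on_dilate_divide[OF that r]) simp
  have w_le: "norm (w z) \<le> norm z" if "norm z < 1" for z
    by (rule Schwarz_Lemma(1)[OF w(1,2) _ that]) (use w(3) in simp)
  define \<phi> where "\<phi> z = of_real r * w (z / of_real r)" for z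
  show ?thesis
  proof (rule that[of \<phi>])
    show "\<phi> holomorphic_on ball 0 r"
      unfolding \<phi>_def by (intro holomorphic_intros comp w)
    show "F holomorphic_on ball 0 r" using comp[OF Fr] r by simp
    show "F z = G (\<phi> z)" if "z \<in> ball 0 r" for z
      using w(4)[OF scale[OF that]] r by (simp add: \<phi>_def)
    show "norm (\<phi> z) \<le> norm z" if "z \<in> ball 0 r" for z
      using w_le[of "z / of_real r"] scale[OF that] r
      by (simp add: \<phi>_def norm_mult norm_divide field_simps)
    fix z0 assume z0: "z0 \<in> ball 0 r" "z0 \<noteq> 0" "\<phi> z0 = z0"
    define u where "u = z0 / of_real r"
    have u: "norm u < 1" "u \<noteq> 0" using scale[OF z0(1)] z0 r by (auto simp: u_def)
    have wu: "w u = u" using z0(3) r by (simp add: \<phi>_def u_def field_simps)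
    have "\<exists>\<alpha>. (\<forall>z. norm z < 1 \<longrightarrow> w z = \<alpha> * z) \<and> norm \<alpha> = 1"
      by (rule Schwarz_Lemma(3)[OF w(1,2) _ u(1)]) (use w(3) u wu in auto)
    then obtain \<alpha> where \<alpha>: "\<And>z. norm z < 1 \<Longrightarrow> w z = \<alpha> * z" by blast
    have "\<alpha> = 1" using \<alpha>[OF u(1)] wu u by simp
    then show "\<forall>z\<in>ball 0 r. \<phi> z = z"
      using \<alpha> scale r by (simp add: \<phi>_def)
  qed
qed

text \<open>
  All that is needed about \<open>Q_fun lam\<close> below the critical radius. A point of the disc lies in a smaller disc of some radius \<open>r\<close>
  on which \<open>Q = P \<circ> \<phi>\<close> with \<open>\<bar>\<phi> z\<bar> \<le> \<bar>z\<bar>\<close>. This factorisation gives the bound and the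
  nonvanishing of \<open>Q\<close>. By the Riccati equation, a critical point other than \<open>0\<close> is a fixed point of \<open>\<phi>\<close>, which
  rigidity in the Schwarz lemma excludes.
\<close>

lemma Q_fun_in_R1_disc:
  assumes lam: "1 + rot lam \<noteq> 0" and z: "z \<in> ball 0 (R1 lam)"
  shows "(Q_fun lam has_field_derivative deriv (Q_fun lam) z) (at z)"
    and "norm z < 1"
    and "norm (Q_fun lam z - 1) \<le> norm z * norm (Q_fun lam z + rot lam)"
    and "Q_fun lam z \<noteq> 0"
    and "deriv (Q_fun lam) z \<noteq> 0"
proof -
  let ?S = "{r. 0 < r \<and> r < 1 \<and> subordinate_in r (Q_fun lam) (P_fun lam)}"
  have "?S \<noteq> {}" using small_radius_subordination[OF lam] by auto
  moreover have "norm z < Sup ?S" using z by (simp add: R1_def)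
  ultimately obtain r where r: "norm z < r" "0 < r" "r < 1"
    and sub: "subordinate_in r (Q_fun lam) (P_fun lam)"
    using less_cSupD[of ?S "norm z"] by auto
  obtain \<phi> where \<phi>: "\<phi> holomorphic_on ball 0 r"
    "\<And>z. z \<in> ball 0 r \<Longrightarrow> Q_fun lam z = P_fun lam (\<phi> z)"
    "\<And>z. z \<in> ball 0 r \<Longrightarrow> norm (\<phi> z) \<le> norm z"
    "\<And>z0. z0 \<in> ball 0 r \<Longrightarrow> z0 \<noteq> 0 \<Longrightarrow> \<phi> z0 = z0 \<Longrightarrow> \<forall>z\<in>ball 0 r. \<phi> z = z"
    "Q_fun lam holomorphic_on ball 0 r"
    by (rule subordinate_in_Schwarz_factor[OF sub r(2)]) (rule that)
  have zr: "z \<in> ball 0 r" using r by simp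
  show z1: "norm z < 1" using r by simp
  show "(Q_fun lam has_field_derivative deriv (Q_fun lam) z) (at z)"
    by (rule holomorphic_derivI[OF \<phi>(5) open_ball zr])
  have \<phi>1: "norm (\<phi> z) < 1" "\<phi> z \<noteq> 1" using \<phi>(3)[OF zr] z1 by auto
  show nz: "Q_fun lam z \<noteq> 0" using P_fun_nonzero[OF \<phi>1(1)] \<phi>(2)[OF zr] by simp
  have "norm (Q_fun lam z - 1) = norm (\<phi> z) * norm (Q_fun lam z + rot lam)"
    using P_fun_minus_one[OF \<phi>1(2), of lam] by (simp add: \<phi>(2)[OF zr] norm_mult)
  also have "\<dots> \<le> norm z * norm (Q_fun lam z + rot lam)"
    by (intro mult_right_mono \<phi>(3)[OF zr]) simp
  finally show "norm (Q_fun lam z - 1) \<le> norm z * norm (Q_fun lam z + rot lam)" .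
  show "deriv (Q_fun lam) z \<noteq> 0"
  proof
    assume crit: "deriv (Q_fun lam) z = 0"
    have z0: "z \<noteq> 0" using crit deriv_Q_fun_0[OF lam] lam by auto
    have "P_fun lam z = P_fun lam (\<phi> z)"
      using Q_fun_riccati[OF z1 nz] crit nz \<phi>(2)[OF zr] by simp
    moreover have "z \<noteq> 1" using z1 by auto
    ultimately have "\<phi> z = z" using P_fun_eq_iff[OF lam _ \<phi>1(2)] by metis
    then have id: "\<forall>z\<in>ball 0 r. \<phi> z = z" using \<phi>(4)[OF zr z0] by simp
    have "(P_fun lam has_field_derivative 1 + rot lam) (at 0)"
      using P_fun_has_derivative[of 0 lam] by simp
    then have "(Q_fun lam has_field_derivative 1 + rot lam) (at 0)"
      by (rule has_field_derivative_transform_within_open[OF _ open_ball, of _ _ _ 0 r])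
         (use r id \<phi>(2) in auto)
    then have "deriv (Q_fun lam) 0 = 1 + rot lam" by (rule DERIV_imp_deriv)
    then show False using deriv_Q_fun_0[OF lam] lam by (simp add: field_simps)
  qed
qed

lemma R1_pos:
  assumes lam: "1 + rot lam \<noteq> 0"
  shows "0 < R1 lam"
proof -
  let ?S = "{r. 0 < r \<and> r < 1 \<and> subordinate_in r (Q_fun lam) (P_fun lam)}"
  obtain r where r: "r \<in> ?S" using small_radius_subordination[OF lam] by auto
  have "bdd_above ?S" by (rule bdd_aboveI[of _ 1]) auto
  then have "r \<le> R1 lam" unfolding R1_def by (rule cSup_upper[OF r])
  then show ?thesis using r by simp
qed

lemma R1_le_1:
  assumes lam: "1 + rot lam \<noteq> 0"
  shows "R1 lam \<le> 1"
  unfolding R1_def using small_radius_subordination[OF lam] by (intro cSup_least) auto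

lemma Q_fun_holomorphic_R1:
  assumes lam: "1 + rot lam \<noteq> 0"
  shows "Q_fun lam holomorphic_on ball 0 (R1 lam)"
  by (subst holomorphic_on_open) (auto intro!: exI Q_fun_in_R1_disc(1)[OF lam])

text \<open>
  The a priori bound for lifts, where \<open>v\<close> is strictly contracting. At \<open>0\<close> the Riccati equations give
  \<open>\<omega>'(0) = v'\<close>, which is the hypothesis on the derivative in \<open>jack_boundary_point\<close>; at the point
  found there they contradict \<open>disc_no_outward_ray\<close>.
\<close>

lemma lift_norm_le:
  assumes lam: "1 + rot lam \<noteq> 0"
    and qhol: "q holomorphic_on ball 0 (R1 lam)" and q0: "q 0 = 1"
    and v: "(v has_field_derivative v') (at 0)" "norm v' < 1" "v 0 = 0"
    and v_less: "\<And>z. z \<in> ball 0 (R1 lam) \<Longrightarrow> z \<noteq> 0 \<Longrightarrow> norm (v z) < norm z"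
    and ode: "\<And>z. z \<in> ball 0 (R1 lam) \<Longrightarrow> z * deriv q z = q z * (P_fun lam (v z) - q z)"
    and lift: "centred_lift (Q_fun lam) (R1 lam) q s \<omega>"
    and s: "s \<le> R1 lam" and z: "z \<in> ball 0 s"
  shows "norm (\<omega> z) \<le> norm z"
proof (rule ccontr)
  assume "\<not> norm (\<omega> z) \<le> norm z"
  then have big: "norm z < norm (\<omega> z)" by simp
  have s0: "0 < s" using z by (auto intro: le_less_trans[OF norm_ge_zero])
  have R0: "0 < R1 lam" by (rule R1_pos[OF lam])
  have \<omega>: "\<omega> holomorphic_on ball 0 s" "\<omega> 0 = 0"
    "\<And>z. z \<in> ball 0 s \<Longrightarrow> \<omega> z \<in> ball 0 (R1 lam)" "\<And>z. z \<in> ball 0 s \<Longrightarrow> Q_fun lam (\<omega> z) = q z"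
    using lift by (auto simp: centred_lift_def)
  have chain: "deriv q z = deriv (Q_fun lam) (\<omega> z) * deriv \<omega> z" if "z \<in> ball 0 s" for z
  proof -
    have "(\<omega> has_field_derivative deriv \<omega> z) (at z)"
      by (rule holomorphic_derivI[OF \<omega>(1) open_ball that])
    then have "((\<lambda>z. Q_fun lam (\<omega> z)) has_field_derivative deriv (Q_fun lam) (\<omega> z) * deriv \<omega> z) (at z)"
      by (rule DERIV_chain2[where f = "Q_fun lam" and g = \<omega>, OF Q_fun_in_R1_disc(1)[OF lam \<omega>(3)[OF that]]])
    then have "(q has_field_derivative deriv (Q_fun lam) (\<omega> z) * deriv \<omega> z) (at z)"
      by (rule has_field_derivative_transform_within_open[OF _ open_ball that]) (rule \<omega>(4))
    then show ?thesis by (rule DERIV_imp_deriv)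
  qed
  have "((\<lambda>z. P_fun lam (v z)) has_field_derivative (1 + rot lam) * v') (at 0)"
    by (rule DERIV_chain2[where f = "P_fun lam" and g = v, OF _ v(1)]) (use P_fun_has_derivative[of 0 lam] v(3) in simp)
  from riccati_derivative_at_0[OF qhol R0 q0 this ode]
  have "(1 + rot lam) * v' = 2 * deriv q 0" .
  also have "deriv q 0 = (1 + rot lam) / 2 * deriv \<omega> 0"
    using chain[of 0] s0 \<omega>(2) by (simp add: deriv_Q_fun_0[OF lam])
  finally have "deriv \<omega> 0 = v'" using lam by simp
  then have small: "norm (deriv \<omega> 0) < 1" using v(2) by simp
  obtain z0 m where z0: "z0 \<noteq> 0" "norm z0 \<le> norm z" "norm (\<omega> z0) = norm z0" "m \<ge> 1"
    "z0 * deriv \<omega> z0 = of_real m * \<omega> z0"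
    by (rule jack_boundary_point[OF \<omega>(1,2) small z big]) (rule that)
  have z0s: "z0 \<in> ball 0 s" and z0R: "z0 \<in> ball 0 (R1 lam)" using z0(2) z s by auto
  define y where "y = \<omega> z0"
  have yR: "y \<in> ball 0 (R1 lam)" using \<omega>(3)[OF z0s] by (simp add: y_def)
  note Q = Q_fun_in_R1_disc[OF lam yR]
  have qy: "q z0 = Q_fun lam y" using \<omega>(4)[OF z0s] by (simp add: y_def)
  have ny: "norm y = norm z0" using z0(3) by (simp add: y_def)
  have "Q_fun lam y * (P_fun lam (v z0) - Q_fun lam y) = z0 * deriv q z0"
    using ode[OF z0R] by (simp add: qy)
  also have "\<dots> = deriv (Q_fun lam) y * (z0 * deriv \<omega> z0)"
    using chain[OF z0s] by (simp add: y_def)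
  also have "\<dots> = of_real m * (y * deriv (Q_fun lam) y)"
    unfolding z0(5) by (simp add: y_def)
  also have "\<dots> = Q_fun lam y * (of_real m * (P_fun lam y - Q_fun lam y))"
    unfolding Q_fun_riccati[OF Q(2) Q(4)] by simp
  finally have outward: "P_fun lam (v z0) - Q_fun lam y = of_real m * (P_fun lam y - Q_fun lam y)"
    using Q(4) by simp
  have vz0: "norm (v z0) < norm y" using v_less[OF z0R z0(1)] ny by simp
  then have v1: "v z0 \<noteq> 1" and y1: "y \<noteq> 1" using Q(2) by auto
  show False
  proof (rule disc_no_outward_ray[OF norm_ge_zero Q(2) _ _ Q(3) z0(4) outward])
    have "0 < norm (P_fun lam (v z0) + rot lam)"
      using lam v1 by (simp add: P_fun_plus_rot)
    then show "norm (P_fun lam (v z0) - 1) < norm y * norm (P_fun lam (v z0) + rot lam)"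
      unfolding P_fun_minus_one[OF v1] norm_mult using vz0 by (rule mult_strict_right_mono[rotated])
    show "norm (P_fun lam y - 1) = norm y * norm (P_fun lam y + rot lam)"
      unfolding P_fun_minus_one[OF y1] norm_mult ..
  qed
qed

section \<open>The subordination\<close>

theorem theorem1:
  fixes lam :: real and q :: "complex \<Rightarrow> complex"
  assumes "- pi / 2 < lam" and "lam < pi / 2"
    and "q holomorphic_on ball 0 1" and "q 0 = 1"
    and "(\<lambda>z. q z + z * deriv q z / q z) \<prec>\<^sub>s P_fun lam"
  shows "subordinate_in (R1 lam) q (Q_fun lam)"
proof -
  note lam = one_plus_rot_nonzero[OF assms(1,2)]
  define R where "R = R1 lam"
  have R: "0 < R" "R \<le> 1" unfolding R_def by (rule R1_pos[OF lam] R1_le_1[OF lam])+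
  obtain w where w: "w holomorphic_on ball 0 1" "w 0 = 0"
    "\<And>z. z \<in> ball 0 1 \<Longrightarrow> norm (w z) < 1"
    "\<And>z. z \<in> ball 0 1 \<Longrightarrow> q z + z * deriv q z / q z = P_fun lam (w z)"
    using assms(5) unfolding subordinate_def by blast
  have w_le: "norm (w z) \<le> norm z" if "norm z < 1" for z
    by (rule Schwarz_Lemma(1)[OF w(1,2) _ that]) (use w(3) in simp)
  have w_deriv: "norm (deriv w 0) \<le> 1"
    by (rule Schwarz_Lemma(2)[OF w(1,2), of 0]) (use w(3) in auto)
  \<comment> \<open>At a zero of \<open>q\<close> the left-hand side of the hypothesis is \<open>0\<close> (division by zero), but \<open>P_fun lam\<close> omits \<open>0\<close>.\<close>
  have qnz: "q z \<noteq> 0" if z: "z \<in> ball 0 1" for z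
  proof
    assume "q z = 0"
    then have "P_fun lam (w z) = 0" using w(4)[OF z] by simp
    then show False using P_fun_nonzero[of "w z"] w(3)[OF z] by simp
  qed
  have ode: "z * deriv q z = q z * (P_fun lam (w z) - q z)" if "z \<in> ball 0 1" for z
    using w(4)[OF that, symmetric] qnz[OF that] by simp
  have Qhol: "Q_fun lam holomorphic_on ball 0 R"
    unfolding R_def by (rule Q_fun_holomorphic_R1[OF lam])
  have Qder: "deriv (Q_fun lam) z \<noteq> 0" if "z \<in> ball 0 R" for z
    using Q_fun_in_R1_disc(5)[OF lam] that by (simp add: R_def)
  \<comment> \<open>Dilating by \<open>\<sigma> < 1\<close> makes \<open>w\<close> strictly contracting, even if \<open>w\<close> is a rotation.\<close>
  have dilated: "\<exists>\<omega>. centred_lift (Q_fun lam) R (\<lambda>z. q (of_real \<sigma> * z)) (\<sigma> * R) \<omega>"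
    if \<sigma>: "0 < \<sigma>" "\<sigma> < 1" for \<sigma> :: real
  proof (rule centred_lift_exists[OF Qhol Qder])
    have in1: "of_real \<sigma> * z \<in> ball 0 1" if "z \<in> ball 0 R" for z :: complex
    proof -
      have "\<sigma> * norm z \<le> norm z" using \<sigma> by (intro mult_left_le_one_le) auto
      then show ?thesis using that R \<sigma> by (simp add: norm_mult)
    qed
    show qhol: "(\<lambda>z. q (of_real \<sigma> * z)) holomorphic_on ball 0 R"
      by (rule holomorphic_on_dilate[OF assms(3)]) (use \<sigma> R mult_mono[of \<sigma> 1 R 1] in simp_all)
    show "q (of_real \<sigma> * 0) = Q_fun lam 0" using assms(4) by simp
    show "0 < \<sigma> * R" "\<sigma> * R < R" using \<sigma> R by auto
    fix s and \<omega> :: "complex \<Rightarrow> complex" and z :: complex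
    assume s: "0 < s" "s \<le> \<sigma> * R" and z: "z \<in> ball 0 s"
      and lift: "centred_lift (Q_fun lam) R (\<lambda>z. q (of_real \<sigma> * z)) s \<omega>"
    have w': "(w has_field_derivative deriv w 0) (at (of_real \<sigma> * 0))"
      using holomorphic_derivI[OF w(1) open_ball, of 0] by simp
    show "norm (\<omega> z) \<le> norm z"
    proof (rule lift_norm_le[OF lam, of "\<lambda>z. q (of_real \<sigma> * z)" "\<lambda>z. w (of_real \<sigma> * z)"
          "deriv w 0 * of_real \<sigma>" s])
      show "((\<lambda>z. w (of_real \<sigma> * z)) has_field_derivative deriv w 0 * of_real \<sigma>) (at 0)"
        by (rule DERIV_chain2[where f = w and g = "\<lambda>z. of_real \<sigma> * z", OF w']) (auto intro!: derivative_eq_intros)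
      have "norm (deriv w 0 * of_real \<sigma>) = norm (deriv w 0) * \<sigma>" using \<sigma> by (simp add: norm_mult)
      also have "\<dots> \<le> 1 * \<sigma>" using w_deriv \<sigma> by (intro mult_right_mono) auto
      also have "\<dots> < 1" using \<sigma> by simp
      finally show "norm (deriv w 0 * of_real \<sigma>) < 1" .
      fix z :: complex assume "z \<in> ball 0 (R1 lam)"
      then have z1: "of_real \<sigma> * z \<in> ball 0 1" using in1 by (simp add: R_def)
      have w_dilated: "norm (w (of_real \<sigma> * z)) \<le> \<sigma> * norm z"
        using w_le[of "of_real \<sigma> * z"] z1 \<sigma> by (simp add: norm_mult)
      show "norm (w (of_real \<sigma> * z)) < norm z" if "z \<noteq> 0"
        by (rule le_less_trans[OF w_dilated]) (use that \<sigma> in simp)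
      have q': "(q has_field_derivative deriv q (of_real \<sigma> * z)) (at (of_real \<sigma> * z))"
        by (rule holomorphic_derivI[OF assms(3) open_ball z1])
      have "((\<lambda>z. q (of_real \<sigma> * z)) has_field_derivative deriv q (of_real \<sigma> * z) * of_real \<sigma>) (at z)"
        by (rule DERIV_chain2[where f = q and g = "\<lambda>z. of_real \<sigma> * z", OF q']) (auto intro!: derivative_eq_intros)
      then have "deriv (\<lambda>z. q (of_real \<sigma> * z)) z = deriv q (of_real \<sigma> * z) * of_real \<sigma>"
        by (rule DERIV_imp_deriv)
      then show "z * deriv (\<lambda>z. q (of_real \<sigma> * z)) z =
          q (of_real \<sigma> * z) * (P_fun lam (w (of_real \<sigma> * z)) - q (of_real \<sigma> * z))"
        using ode[OF z1] by (simp add: mult_ac)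
    next
      show "s \<le> R1 lam" using s \<open>\<sigma> * R < R\<close> by (simp add: R_def)
    qed (use lift qhol assms(4) w(2) z in \<open>simp_all add: R_def\<close>)
  qed
  have "\<exists>\<omega>. centred_lift (Q_fun lam) R q a \<omega>" if a: "0 < a" "a < R" for a
  proof -
    \<comment> \<open>One factor \<open>\<sigma>\<close> is lost in restricting to radius \<open>\<sigma> R\<close>, another in undoing the dilation.\<close>
    define \<sigma> where "\<sigma> = sqrt (a / R)"
    have \<sigma>: "0 < \<sigma>" "\<sigma> < 1" using a R by (auto simp: \<sigma>_def)
    have \<sigma>2: "\<sigma> * \<sigma> * R = a" using a R by (simp add: \<sigma>_def)
    obtain \<omega> where \<omega>: "centred_lift (Q_fun lam) R (\<lambda>z. q (of_real \<sigma> * z)) (\<sigma> * R) \<omega>"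
      using dilated[OF \<sigma>] by blast
    have inb: "z / of_real \<sigma> \<in> ball 0 (\<sigma> * R)" if "z \<in> ball 0 a" for z :: complex
      using that \<sigma> by (simp add: norm_divide divide_simps \<sigma>2[symmetric] mult_ac)
    have "centred_lift (Q_fun lam) R q a (\<lambda>z. \<omega> (z / of_real \<sigma>))"
      unfolding centred_lift_def
    proof (intro conjI ballI)
      have \<omega>hol: "\<omega> holomorphic_on ball 0 (\<sigma> * R)" using \<omega> by (simp add: centred_lift_def)
      show "(\<lambda>z. \<omega> (z / of_real \<sigma>)) holomorphic_on ball 0 a"
        by (rule holomorphic_on_dilate_divide[OF \<omega>hol \<sigma>(1)]) (simp add: \<sigma>2[symmetric] mult_ac)
      show "\<omega> (z / of_real \<sigma>) \<in> ball 0 R" "Q_fun lam (\<omega> (z / of_real \<sigma>)) = q z"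
        if "z \<in> ball 0 a" for z
        using \<omega> inb[OF that] \<sigma> unfolding centred_lift_def by auto
      show "\<omega> (0 / of_real \<sigma>) = 0" using \<omega> by (simp add: centred_lift_def)
    qed
    then show ?thesis by blast
  qed
  then obtain \<omega> where "centred_lift (Q_fun lam) R q R \<omega>"
    using centred_lift_glue[OF Qhol R(1) Qder[of 0]] R(1) by auto
  then have \<omega>: "\<omega> holomorphic_on ball 0 R" "\<omega> 0 = 0"
    "\<And>z. z \<in> ball 0 R \<Longrightarrow> norm (\<omega> z) < R" "\<And>z. z \<in> ball 0 R \<Longrightarrow> Q_fun lam (\<omega> z) = q z"
    by (auto simp: centred_lift_def)
  have scale: "of_real R * z \<in> ball 0 R" if "z \<in> ball 0 1" for z :: complex
    using that R by (simp add: norm_mult)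
  have comp: "(\<lambda>z. g (of_real R * z)) holomorphic_on ball 0 1" if "g holomorphic_on ball 0 R" for g
    by (rule holomorphic_on_dilate[OF that]) (use R in simp_all)
  show ?thesis
    unfolding subordinate_in_def subordinate_def R_def[symmetric]
  proof (intro conjI exI[of _ "\<lambda>z. \<omega> (of_real R * z) / of_real R"] ballI)
    show "(\<lambda>z. q (of_real R * z)) holomorphic_on ball 0 1"
      by (rule comp, rule holomorphic_on_subset[OF assms(3)]) (use R in auto)
    show "(\<lambda>z. Q_fun lam (of_real R * z)) holomorphic_on ball 0 1" by (rule comp[OF Qhol])
    show "(\<lambda>z. \<omega> (of_real R * z) / of_real R) holomorphic_on ball 0 1"
      using comp[OF \<omega>(1)] R by (intro holomorphic_on_divide) auto
    fix z :: complex assume z: "z \<in> ball 0 1"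
    show "norm (\<omega> (of_real R * z) / of_real R) < 1"
      using \<omega>(3)[OF scale[OF z]] R by (simp add: norm_divide)
    show "q (of_real R * z) = Q_fun lam (of_real R * (\<omega> (of_real R * z) / of_real R))"
      using \<omega>(4)[OF scale[OF z]] R by simp
  qed (simp add: \<omega>)
qed

end
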